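(* Let $p>3$ be a prime. Then $$\sum_{\psi \bmod p} \left|\sum_{u=1}^{p-1} \sum_{a=1}^{p-1} \overline{\psi}(ua-1)\,\psi(u\overline{a}-1)\,\psi^2(a-1)\right|^2=(p-1)(p^3-8p^2+29p-53).$$
   Context: For an integer $a$ coprime to $p$, $\overline{a}$ denotes an integer with $a\overline{a}\equiv 1 \pmod p$. The sum runs over all $p-1$ Dirichlet characters $\psi$ modulo $p$; $\overline{\psi}$ is the complex conjugate character, and every character (including the principal one) takes the value $0$ at multiples of $p$. *)

theory Defs
  imports Complex_Main "HOL-Number_Theory.Number_Theory"
begin

text \<open>
  Dirichlet characters modulo \<open>n\<close>, as functions on all integers that vanish exactly at the
  integers not coprime to \<open>n\<close> (also for the principal character).  The value 1 at 1 follows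
  from multiplicativity, as the value there is nonzero.
\<close>
definition dirichlet_char :: "nat \<Rightarrow> (int \<Rightarrow> complex) \<Rightarrow> bool" where
  "dirichlet_char n \<psi> \<longleftrightarrow>
     (\<forall>a. \<psi> (a + int n) = \<psi> a) \<and>
     (\<forall>a b. \<psi> (a * b) = \<psi> a * \<psi> b) \<and>
     (\<forall>a. \<psi> a = 0 \<longleftrightarrow> \<not> coprime a (int n))"

definition dirichlet_chars :: "nat \<Rightarrow> (int \<Rightarrow> complex) set" where
  "dirichlet_chars n = {\<psi>. dirichlet_char n \<psi>}"

lemma dirichlet_char_mod:
  assumes "dirichlet_char n \<psi>"
  shows "\<psi> (a mod int n) = \<psi> a"
proof -
  have step: "\<psi> (b + int n) = \<psi> b" for b
    using assms by (simp add: dirichlet_char_def)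
  have nat_mult: "\<psi> (b + int k * int n) = \<psi> b" for b k
  proof (induction k)
    case (Suc k)
    have "b + int (Suc k) * int n = (b + int k * int n) + int n"
      by (simp add: algebra_simps)
    then show ?case using Suc step by metis
  qed simp
  have int_mult: "\<psi> (b + m * int n) = \<psi> b" for b m
  proof (cases "m \<ge> 0")
    case True
    then show ?thesis using nat_mult[of b "nat m"] by simp
  next
    case False
    then show ?thesis using nat_mult[of "b + m * int n" "nat (- m)"] by simp
  qed
  show ?thesis
    using int_mult[of "a mod int n" "a div int n"] by simp
qed

text \<open>
  Sums over an infinite set are 0 by convention; this shows that sums over
  all characters modulo \<open>n\<close> are genuine sums.
\<close>
lemma finite_dirichlet_chars:
  assumes "n > 0"
  shows "finite (dirichlet_chars n)"
proof -
  let ?R = "insert 0 {z :: complex. z ^ totient n = 1}"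
  have finR: "finite ?R"
    using finite_roots_unity[of "totient n"] assms by (simp add: Suc_leI)
  have val: "\<psi> a \<in> ?R" if "dirichlet_char n \<psi>" for \<psi> a
  proof (cases "coprime a (int n)")
    case True
    have mult: "\<psi> (x * y) = \<psi> x * \<psi> y" and zero: "\<psi> x = 0 \<longleftrightarrow> \<not> coprime x (int n)" for x y
      using that by (auto simp: dirichlet_char_def)
    have one: "\<psi> 1 = 1"
      using mult[of 1 1] zero[of 1] by simp
    have pow: "\<psi> (x ^ k) = \<psi> x ^ k" for x k
      by (induction k) (simp_all add: one mult)
    define b where "b = nat (a mod int n)"
    have b: "int b = a mod int n" using assms by (simp add: b_def)
    have "coprime (int b) (int n)" using True assms by (simp add: b)
    then have "[b ^ totient n = 1] (mod n)"
      using euler_theorem by simp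
    then have "[int b ^ totient n = 1] (mod int n)"
      using cong_int_iff[of "b ^ totient n" 1 n] by simp
    then have "\<psi> (int b ^ totient n) = \<psi> 1"
      unfolding cong_def using dirichlet_char_mod[OF that] by metis
    then have "\<psi> a ^ totient n = 1"
      using pow one b dirichlet_char_mod[OF that, of a] by simp
    then show ?thesis by simp
  next
    case False
    then show ?thesis using that by (simp add: dirichlet_char_def)
  qed
  have "inj_on (\<lambda>\<psi>. restrict \<psi> {0..<int n}) (dirichlet_chars n)"
  proof (rule inj_onI, rule ext)
    fix \<psi> \<phi> a
    assume *: "\<psi> \<in> dirichlet_chars n" "\<phi> \<in> dirichlet_chars n"
      "restrict \<psi> {0..<int n} = restrict \<phi> {0..<int n}"
    have "\<psi> (a mod int n) = \<phi> (a mod int n)"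
      using fun_cong[OF *(3), of "a mod int n"] assms by simp
    then show "\<psi> a = \<phi> a"
      using *(1,2) dirichlet_char_mod unfolding dirichlet_chars_def by (metis mem_Collect_eq)
  qed
  moreover have "(\<lambda>\<psi>. restrict \<psi> {0..<int n}) ` dirichlet_chars n \<subseteq> {0..<int n} \<rightarrow>\<^sub>E ?R"
  proof (rule image_subsetI)
    fix \<psi> assume "\<psi> \<in> dirichlet_chars n"
    then have "\<psi> a \<in> ?R" for a
      by (intro val) (simp add: dirichlet_chars_def)
    then show "restrict \<psi> {0..<int n} \<in> {0..<int n} \<rightarrow>\<^sub>E ?R"
      by (simp only: restrict_PiE_iff) blast
  qed
  then have "finite ((\<lambda>\<psi>. restrict \<psi> {0..<int n}) ` dirichlet_chars n)"
    by (rule finite_subset) (intro finite_PiE finR finite_atLeastLessThan_int)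
  ultimately show ?thesis
    using finite_imageD by blast
qed

end

theory Submission
  imports Defs
begin

text \<open>
  Each term is \<open>\<psi>\<close> of the single residue \<open>(u/a - 1) (a - 1)\<^sup>2 / (u a - 1)\<close>, so by Parseval for the
  character group the left-hand side is \<open>p - 1\<close> times the sum of \<open>N(c)\<^sup>2\<close>, where \<open>N(c)\<close> counts the
  pairs \<open>(u, a)\<close> whose residue is \<open>c \<noteq> 0\<close>.  For \<open>a = 1\<close> there is no such \<open>u\<close>; for \<open>a = -1\<close> the
  residue is \<open>4\<close> for all \<open>p - 2\<close> admissible \<open>u\<close>; for every other \<open>a\<close> it is an injective Moebius function
  of \<open>u\<close>, which misses \<open>c\<close> precisely when \<open>(a - 1)\<^sup>2 \<in> {c, c a\<^sup>2}\<close> (solution \<open>u = 0\<close> or \<open>u = \<infinity>\<close>).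
  These exceptional \<open>a\<close> exist only for squares \<open>c = s\<^sup>2\<close>, where they are \<open>1 \<plusminus> s\<close> and their inverses:
  two of them if \<open>c \<in> {1, 4}\<close> and four otherwise.  Hence \<open>N\<close> takes the values \<open>p - 3\<close> on
  non-squares, \<open>p - 5\<close> at \<open>1\<close>, \<open>2 p - 7\<close> at \<open>4\<close> and \<open>p - 7\<close> on the other \<open>(p - 5)/2\<close> squares.
\<close>

section \<open>Orthogonality of Dirichlet characters\<close>

lemma dirichlet_char_cong:
  assumes "dirichlet_char n \<psi>" "[a = b] (mod int n)"
  shows "\<psi> a = \<psi> b"
  using assms dirichlet_char_mod[OF assms(1)] unfolding cong_def by metis

lemma dirichlet_char_power:
  assumes "dirichlet_char n \<psi>"
  shows "\<psi> (a ^ k) = \<psi> a ^ k"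
proof (induction k)
  case 0
  have "\<psi> (1 * 1) = \<psi> 1 * \<psi> 1"
    using assms unfolding dirichlet_char_def by blast
  moreover have "\<psi> 1 \<noteq> 0"
    using assms unfolding dirichlet_char_def by simp
  ultimately show ?case by simp
next
  case (Suc k)
  then show ?case using assms by (simp add: dirichlet_char_def)
qed

lemma residue_primroot_power_int:
  assumes "residue_primroot n g" "n > 1" "coprime a (int n)"
  obtains i where "i < totient n" "[int g ^ i = a] (mod int n)"
proof -
  define b where "b = nat (a mod int n)"
  have b: "int b = a mod int n"
    using assms by (simp add: b_def)
  have "coprime (int b) (int n)"
    using assms(2,3) by (simp add: b)
  then have "coprime b n"
    by simp
  moreover have "b < n"
    using assms(2) by (simp add: b_def nat_less_iff)
  moreover have "b \<noteq> 0"
    using \<open>coprime b n\<close> assms(2) by (intro notI) simp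
  ultimately have "b \<in> totatives n"
    by (simp add: totatives_def)
  then obtain i where "i < totient n" "b = g ^ i mod n"
    using residue_primroot_is_generator[OF assms(2,1)] by (auto simp: bij_betw_def)
  then have "[int g ^ i = a] (mod int n)"
    using b unfolding cong_def by (simp add: zmod_int)
  with \<open>i < totient n\<close> show ?thesis
    by (rule that)
qed

lemma residue_primroot_power_cong_iff:
  assumes "residue_primroot n g"
  shows "[int g ^ i = int g ^ j] (mod int n) \<longleftrightarrow> [i = j] (mod totient n)"
  using assms order_divides_expdiff[of n g i j] cong_int_iff[of "g ^ i" "g ^ j" n]
  by (simp add: residue_primroot_def)

text \<open>The character is \<open>z\<close> raised to the discrete logarithm of its argument.
  Logarithms are determined only modulo \<open>totient n\<close>, which is harmless because
  \<open>z ^ totient n = 1\<close>.\<close>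

lemma dirichlet_char_of_root:
  assumes g: "residue_primroot n g" and n: "n > 1" and z: "z ^ totient n = 1"
  shows "\<exists>\<psi>. dirichlet_char n \<psi> \<and> \<psi> (int g) = z"
proof -
  define ind where "ind a = (SOME i. [int g ^ i = a] (mod int n))" for a
  have ind: "[int g ^ ind a = a] (mod int n)" if "coprime a (int n)" for a
    unfolding ind_def by (rule someI_ex) (use residue_primroot_power_int[OF g n that] in blast)
  have z0: "z \<noteq> 0"
    using z n by (auto simp: power_0_left split: if_splits)
  have zmod: "z ^ (i mod totient n) = z ^ i" for i
  proof -
    have "z ^ i = z ^ (totient n * (i div totient n) + i mod totient n)"
      by simp
    also have "\<dots> = z ^ (i mod totient n)"
      unfolding power_add power_mult z by simp
    finally show ?thesis ..
  qed
  have z_ind: "z ^ ind a = z ^ i" if "[int g ^ i = a] (mod int n)" "coprime a (int n)" for a i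
  proof -
    have "[int g ^ ind a = int g ^ i] (mod int n)"
      using ind[OF that(2)] that(1) cong_sym cong_trans by blast
    then have "ind a mod totient n = i mod totient n"
      using residue_primroot_power_cong_iff[OF g] by (simp add: cong_def)
    then show ?thesis by (metis zmod)
  qed
  define \<psi> where "\<psi> a = (if coprime a (int n) then z ^ ind a else 0)" for a
  \<comment> \<open>The predicate behind the choice \<open>ind\<close> sees \<open>a\<close> only
    through \<open>a mod n\<close>, so \<open>a\<close> and \<open>a + n\<close> receive the very
    same exponent.\<close>
  have "\<psi> (a + int n) = \<psi> a" for a
    by (simp add: \<psi>_def ind_def cong_def coprime_iff_gcd_eq_1)
  moreover have "\<psi> (a * b) = \<psi> a * \<psi> b" for a b
  proof (cases "coprime a (int n) \<and> coprime b (int n)")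
    case True
    then have "[int g ^ (ind a + ind b) = a * b] (mod int n)"
      unfolding power_add by (intro cong_mult ind) auto
    with True show ?thesis
      using z_ind[of "ind a + ind b" "a * b"] by (simp add: \<psi>_def power_add)
  qed (auto simp: \<psi>_def)
  moreover have "\<psi> a = 0 \<longleftrightarrow> \<not> coprime a (int n)" for a
    using z0 by (simp add: \<psi>_def)
  moreover have "\<psi> (int g) = z"
    using z_ind[of 1 "int g"] g by (simp add: \<psi>_def residue_primroot_def coprime_commute)
  ultimately show ?thesis
    unfolding dirichlet_char_def by blast
qed

text \<open>Every unit is a power of \<open>g\<close>, so a character is determined by its value at
  \<open>g\<close>. This turns sums over characters into sums over roots of unity.\<close>

lemma bij_betw_dirichlet_chars_roots:
  assumes g: "residue_primroot n g" and n: "n > 1"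
  shows "bij_betw (\<lambda>\<psi>. \<psi> (int g)) (dirichlet_chars n) {z. z ^ totient n = 1}"
  unfolding bij_betw_def
proof
  show "inj_on (\<lambda>\<psi>. \<psi> (int g)) (dirichlet_chars n)"
  proof (rule inj_onI, rule ext)
    fix \<psi> \<phi> a
    assume "\<psi> \<in> dirichlet_chars n" "\<phi> \<in> dirichlet_chars n" and eq: "\<psi> (int g) = \<phi> (int g)"
    then have chars: "dirichlet_char n \<psi>" "dirichlet_char n \<phi>"
      by (simp_all add: dirichlet_chars_def)
    show "\<psi> a = \<phi> a"
    proof (cases "coprime a (int n)")
      case True
      then obtain i where "[int g ^ i = a] (mod int n)"
        using residue_primroot_power_int[OF g n] by blast
      then have "\<psi> a = \<psi> (int g) ^ i" "\<phi> a = \<phi> (int g) ^ i"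
        using chars dirichlet_char_cong dirichlet_char_power by metis+
      then show ?thesis
        using eq by simp
    next
      case False
      then show ?thesis
        using chars unfolding dirichlet_char_def by metis
    qed
  qed
  have "\<psi> (int g) ^ totient n = 1" if "dirichlet_char n \<psi>" for \<psi>
  proof -
    have "[int g ^ totient n = int g ^ 0] (mod int n)"
      by (subst residue_primroot_power_cong_iff[OF g]) (simp add: cong_def)
    then show ?thesis
      using that dirichlet_char_cong dirichlet_char_power by (metis power_0)
  qed
  then show "(\<lambda>\<psi>. \<psi> (int g)) ` dirichlet_chars n = {z. z ^ totient n = 1}"
    using dirichlet_char_of_root[OF g n] by (fastforce simp: dirichlet_chars_def)
qed

lemma sum_roots_unity_orthogonal:
  assumes "i < n" "j < n"
  shows "(\<Sum>z | z ^ n = 1. z ^ i * cnj z ^ j) = (if i = j then of_nat n else (0 :: complex))"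
proof -
  define e where "e k = cis (2 * pi * real k / real n)" for k
  have n: "n > 0" using assms by simp
  have bij: "bij_betw e {..<n} {z. z ^ n = 1}"
    unfolding e_def by (rule bij_betw_roots_unity[OF n])
  define w where "w = e i * cnj (e j)"
  have e1: "e i ^ n = 1" "e j ^ n = 1"
    using bij assms by (auto simp: bij_betw_def)
  \<comment> \<open>This symmetry turns powers of varying roots into powers of a fixed one, so the
    sum becomes a geometric series in \<open>w\<close>.\<close>
  have e_pow: "e k ^ l = e l ^ k" for k l
    by (simp add: e_def DeMoivre mult.commute mult.left_commute)
  have norm_e: "e k * cnj (e k) = 1" for k
    by (simp add: e_def cis_cnj cis_mult)
  have "(\<Sum>z | z ^ n = 1. z ^ i * cnj z ^ j) = (\<Sum>k<n. e k ^ i * cnj (e k) ^ j)"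
    by (rule sum.reindex_bij_betw[OF bij, symmetric])
  also have "\<dots> = (\<Sum>k<n. w ^ k)"
    by (simp add: w_def power_mult_distrib e_pow flip: complex_cnj_power)
  also have "\<dots> = (if i = j then of_nat n else 0)"
  proof (cases "i = j")
    case True
    then show ?thesis by (simp add: w_def norm_e)
  next
    case False
    have "w \<noteq> 1"
    proof
      assume "w = 1"
      then have "e i = e j"
        using norm_e[of j] unfolding w_def by (metis mult.assoc mult.commute mult_1)
      with assms False bij show False
        by (auto simp: bij_betw_def inj_on_def)
    qed
    moreover have "w ^ n = 1"
      by (simp add: w_def power_mult_distrib e1 flip: complex_cnj_power)
    ultimately show ?thesis
      using False by (simp add: geometric_sum)
  qed
  finally show ?thesis .
qed

lemma sum_dirichlet_chars_orthogonal:
  assumes g: "residue_primroot n g" and n: "n > 1" and ab: "coprime a (int n)" "coprime b (int n)"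
  shows "(\<Sum>\<psi>\<in>dirichlet_chars n. \<psi> a * cnj (\<psi> b)) =
           (if [a = b] (mod int n) then of_nat (totient n) else 0)"
proof -
  obtain i where i: "i < totient n" "[int g ^ i = a] (mod int n)"
    using residue_primroot_power_int[OF g n ab(1)] .
  obtain j where j: "j < totient n" "[int g ^ j = b] (mod int n)"
    using residue_primroot_power_int[OF g n ab(2)] .
  have val: "\<psi> a = \<psi> (int g) ^ i" "\<psi> b = \<psi> (int g) ^ j" if "\<psi> \<in> dirichlet_chars n" for \<psi>
    using that i(2) j(2) dirichlet_char_cong dirichlet_char_power
    unfolding dirichlet_chars_def by (metis mem_Collect_eq)+
  have "(\<Sum>\<psi>\<in>dirichlet_chars n. \<psi> a * cnj (\<psi> b)) =
        (\<Sum>\<psi>\<in>dirichlet_chars n. \<psi> (int g) ^ i * cnj (\<psi> (int g)) ^ j)"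
    by (simp add: val)
  also have "\<dots> = (\<Sum>z | z ^ totient n = 1. z ^ i * cnj z ^ j)"
    by (rule sum.reindex_bij_betw[OF bij_betw_dirichlet_chars_roots[OF g n]])
  also have "\<dots> = (if i = j then of_nat (totient n) else 0)"
    by (rule sum_roots_unity_orthogonal) (use i j in auto)
  also have "i = j \<longleftrightarrow> [i = j] (mod totient n)"
    using i j by (simp add: cong_def)
  also have "\<dots> \<longleftrightarrow> [int g ^ i = int g ^ j] (mod int n)"
    by (rule residue_primroot_power_cong_iff[OF g, symmetric])
  also have "\<dots> \<longleftrightarrow> [a = b] (mod int n)"
    using i j by (simp add: cong_def)
  finally show ?thesis .
qed

text \<open>Expanding the squared modulus and summing over the characters first leaves only the
  terms with \<open>c\<close> congruent to \<open>d\<close>. As \<open>C\<close> lies in one period,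
  these are the diagonal terms.\<close>

lemma dirichlet_chars_parseval:
  assumes g: "residue_primroot n g" and n: "n > 1"
    and C: "C \<subseteq> {0..<int n}" "\<And>c. c \<in> C \<Longrightarrow> coprime c (int n)"
  shows "(\<Sum>\<psi>\<in>dirichlet_chars n. cmod (\<Sum>c\<in>C. w c * \<psi> c) ^ 2) =
           real (totient n) * (\<Sum>c\<in>C. cmod (w c) ^ 2)"
proof -
  have fin: "finite C"
    using C(1) finite_subset by blast
  have inner: "(\<Sum>d\<in>C. w c * cnj (w d) * (\<Sum>\<psi>\<in>dirichlet_chars n. \<psi> c * cnj (\<psi> d))) =
                 of_nat (totient n) * of_real (cmod (w c) ^ 2)" if c: "c \<in> C" for c
  proof -
    have "(\<Sum>d\<in>C. w c * cnj (w d) * (\<Sum>\<psi>\<in>dirichlet_chars n. \<psi> c * cnj (\<psi> d))) =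
          (\<Sum>d\<in>C. if c = d then w c * cnj (w d) * of_nat (totient n) else 0)"
    proof (rule sum.cong[OF refl])
      fix d assume "d \<in> C"
      then have "[c = d] (mod int n) \<longleftrightarrow> c = d"
        using c C(1) by (auto simp: cong_def subset_iff)
      then show "w c * cnj (w d) * (\<Sum>\<psi>\<in>dirichlet_chars n. \<psi> c * cnj (\<psi> d)) =
                   (if c = d then w c * cnj (w d) * of_nat (totient n) else 0)"
        using sum_dirichlet_chars_orthogonal[OF g n C(2)[OF c] C(2)[OF \<open>d \<in> C\<close>]] by simp
    qed
    then show ?thesis
      using c fin by (simp add: complex_norm_square mult.commute del: of_real_power)
  qed
  \<comment> \<open>The identity is proved over the complex numbers, where the squared modulus is a
    product with the conjugate, and pulled back along the injective \<open>of_real\<close>.\<close>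
  have "complex_of_real (\<Sum>\<psi>\<in>dirichlet_chars n. cmod (\<Sum>c\<in>C. w c * \<psi> c) ^ 2) =
        (\<Sum>\<psi>\<in>dirichlet_chars n. \<Sum>c\<in>C. \<Sum>d\<in>C. w c * cnj (w d) * (\<psi> c * cnj (\<psi> d)))"
    by (simp add: complex_norm_square sum_product mult_ac del: of_real_power)
  also have "\<dots> = (\<Sum>c\<in>C. \<Sum>d\<in>C. w c * cnj (w d) * (\<Sum>\<psi>\<in>dirichlet_chars n. \<psi> c * cnj (\<psi> d)))"
    by (subst sum.swap, rule sum.cong[OF refl], subst sum.swap) (simp add: sum_distrib_left)
  also have "\<dots> = complex_of_real (real (totient n) * (\<Sum>c\<in>C. cmod (w c) ^ 2))"
    by (simp add: inner flip: sum_distrib_left)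
  finally show ?thesis
    by (simp only: of_real_eq_iff)
qed

text \<open>On units the values have modulus 1, so conjugation is inversion of the value, which
  multiplicativity moves into the argument.\<close>

lemma cnj_dirichlet_char:
  assumes g: "residue_primroot n g" and n: "n > 1" and \<psi>: "dirichlet_char n \<psi>"
  shows "cnj (\<psi> x) = \<psi> (modular_inverse (int n) x)"
proof (cases "coprime x (int n)")
  case True
  define z where "z = \<psi> (int g)"
  have z: "z ^ totient n = 1"
    using bij_betw_apply[OF bij_betw_dirichlet_chars_roots[OF g n]] \<psi>
    by (auto simp: z_def dirichlet_chars_def)
  have "norm z = 1"
    using power_eq_1_iff[OF z] n by simp
  moreover obtain i where "[int g ^ i = x] (mod int n)"
    using residue_primroot_power_int[OF g n True] by blast
  then have "\<psi> x = z ^ i"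
    using \<psi> dirichlet_char_cong dirichlet_char_power unfolding z_def by metis
  ultimately have "norm (\<psi> x) = 1"
    by (simp add: norm_power)
  then have "cnj (\<psi> x) * \<psi> x = 1"
    by (simp add: complex_norm_square[symmetric] mult.commute)
  moreover have "\<psi> (x * modular_inverse (int n) x) = \<psi> (x ^ 0)"
    using dirichlet_char_cong[OF \<psi> cong_modular_inverse1[OF True]] by simp
  then have "\<psi> x * \<psi> (modular_inverse (int n) x) = 1"
    using \<psi> dirichlet_char_power[OF \<psi>, of x 0] by (simp add: dirichlet_char_def)
  ultimately show ?thesis
    by (metis mult.assoc mult.right_neutral mult_1)
next
  \<comment> \<open>The modular inverse of a non-unit is 0 by default, so both sides vanish.\<close>
  case False
  moreover have "\<not> coprime 0 (int n)"
    using n by simp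
  ultimately have "\<psi> x = 0" "\<psi> 0 = 0"
    using \<psi> unfolding dirichlet_char_def by blast+
  then show ?thesis
    using False by simp
qed

section \<open>Counting the pairs with a given residue\<close>

text \<open>The default inverse 0 makes the residue 0 when \<open>P\<close> divides
  \<open>u * a - 1\<close>, in agreement with the vanishing of the character there.\<close>

definition quot_residue :: "int \<Rightarrow> int \<Rightarrow> int \<Rightarrow> int" where
  "quot_residue P u a =
     (modular_inverse P (u * a - 1) * (u * modular_inverse P a - 1) * (a - 1) ^ 2) mod P"

locale int_prime =
  fixes P :: int
  assumes prime: "prime P"
begin

section \<open>Divisibility and inverses modulo a prime\<close>

lemma P_gt_1: "P > 1"
  using prime prime_gt_1_int by blast

lemma coprime_iff: "coprime x P \<longleftrightarrow> \<not> P dvd x"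
  using prime by (metis coprime_commute coprime_absorb_right not_prime_unit prime_imp_coprime)

lemma not_dvd_range: "0 < x \<Longrightarrow> x < P \<Longrightarrow> \<not> P dvd x"
  using zdvd_not_zless by blast

lemma dvd_mult_iff: "P dvd x * y \<longleftrightarrow> P dvd x \<or> P dvd y"
  by (rule prime_dvd_mult_iff[OF prime])

lemma dvd_power2_iff: "P dvd x ^ 2 \<longleftrightarrow> P dvd x"
  by (simp add: prime prime_dvd_power_iff)

lemma inverse_cong: "\<not> P dvd x \<Longrightarrow> [x * modular_inverse P x = 1] (mod P)"
  by (rule cong_modular_inverse1) (simp add: coprime_iff)

lemma dvd_modular_inverse_iff: "P dvd modular_inverse P x \<longleftrightarrow> P dvd x"
  using coprime_modular_inverse[of x P] coprime_iff
  by (cases "P dvd x") auto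

text \<open>Denominators are cleared by multiplying with the unit \<open>a * (u * a - 1)\<close>. If
  that is not a unit, the residue is 0 and differs from \<open>c\<close>.\<close>

lemma quot_residue_eq_iff:
  assumes a: "\<not> P dvd a" and c: "c \<in> {1..P-1}"
  shows "quot_residue P u a = c \<longleftrightarrow>
           \<not> P dvd u * a - 1 \<and> [(u - a) * (a - 1) ^ 2 = c * a * (u * a - 1)] (mod P)"
proof (cases "P dvd u * a - 1")
  case True
  then show ?thesis
    using c by (simp add: quot_residue_def coprime_iff)
next
  case False
  define i where "i = modular_inverse P (u * a - 1)"
  define b where "b = modular_inverse P a"
  have i: "P dvd (u * a - 1) * i - 1"
    using inverse_cong[OF False] by (simp add: i_def cong_iff_dvd_diff)
  have b: "P dvd a * b - 1"
    using inverse_cong[OF a] by (simp add: b_def cong_iff_dvd_diff)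
  have "quot_residue P u a = c \<longleftrightarrow> [i * (u * b - 1) * (a - 1) ^ 2 = c] (mod P)"
    using c by (simp add: quot_residue_def i_def b_def cong_def)
  also have "\<dots> \<longleftrightarrow> P dvd a * (u * a - 1) * (i * (u * b - 1) * (a - 1) ^ 2 - c)"
    using False a by (simp add: cong_iff_dvd_diff dvd_mult_iff)
  \<comment> \<open>The second summand collects the errors of replacing \<open>i\<close> and
    \<open>b\<close> by true inverses; it is a multiple of \<open>P\<close>.\<close>
  also have "a * (u * a - 1) * (i * (u * b - 1) * (a - 1) ^ 2 - c) =
      ((u - a) * (a - 1) ^ 2 - c * a * (u * a - 1)) +
      (((u * a - 1) * i - 1) * (a * (u * b - 1) * (a - 1) ^ 2) + (a * b - 1) * (u * (a - 1) ^ 2))"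
    by (simp add: algebra_simps power2_eq_square)
  also have "P dvd \<dots> \<longleftrightarrow> P dvd (u - a) * (a - 1) ^ 2 - c * a * (u * a - 1)"
    by (rule dvd_add_left_iff) (intro dvd_add dvd_mult2 i b)
  finally show ?thesis
    using False by (simp add: cong_iff_dvd_diff)
qed

text \<open>On the projective line there is exactly one solution. It is lost when it is the point at
  infinity (\<open>D\<close> vanishes) or 0 (\<open>R\<close> vanishes).\<close>

lemma card_linear_cong:
  assumes DR: "\<not> (P dvd D \<and> P dvd R)"
  shows "card {u \<in> {1..P-1}. [u * D = R] (mod P)} = (if P dvd D \<or> P dvd R then 0 else 1)"
proof (cases "P dvd D \<or> P dvd R")
  case True
  have "\<not> [u * D = R] (mod P)" if "u \<in> {1..P-1}" for u
    using that DR True not_dvd_range[of u] cong_dvd_iff[of "u * D" R P] by (auto simp: dvd_mult_iff)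
  then have "{u \<in> {1..P-1}. [u * D = R] (mod P)} = {}"
    by blast
  with True show ?thesis by (simp only: card.empty if_True)
next
  case False
  define v where "v = (modular_inverse P D * R) mod P"
  have "{u \<in> {1..P-1}. [u * D = R] (mod P)} = {v}"
  proof (intro equalityI subsetI)
    fix u assume "u \<in> {u \<in> {1..P-1}. [u * D = R] (mod P)}"
    then have u: "u \<in> {1..P-1}" "[u * D = R] (mod P)" by auto
    have "[modular_inverse P D * R = modular_inverse P D * (u * D)] (mod P)"
      using u by (intro cong_mult cong_refl) (simp add: cong_sym)
    also have "modular_inverse P D * (u * D) = D * modular_inverse P D * u"
      by (simp add: mult_ac)
    also have "[\<dots> = 1 * u] (mod P)"
      using False by (intro cong_mult cong_refl inverse_cong) auto
    finally show "u \<in> {v}"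
      using u by (simp add: v_def cong_def)
  next
    fix u assume "u \<in> {v}"
    then have u: "u = v" by simp
    have "\<not> P dvd v"
      using False by (simp add: v_def dvd_mod_iff dvd_mult_iff dvd_modular_inverse_iff)
    then have "v \<noteq> 0" by auto
    moreover have "0 \<le> v" "v < P"
      using P_gt_1 by (simp_all add: v_def)
    ultimately have "v \<in> {1..P-1}"
      by auto
    have "[v * D = modular_inverse P D * R * D] (mod P)"
      unfolding v_def by (intro cong_mult) auto
    then have "[v * D = D * modular_inverse P D * R] (mod P)"
      by (simp add: mult_ac)
    then have "[v * D = R] (mod P)"
      using cong_mult[OF inverse_cong[of D] cong_refl[of R]] False cong_trans by fastforce
    with \<open>v \<in> {1..P-1}\<close> show "u \<in> {u \<in> {1..P-1}. [u * D = R] (mod P)}"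
      using u by simp
  qed
  with False show ?thesis by (simp del: mem_Collect_eq)
qed

section \<open>Number of solutions \<open>u\<close> for a fixed \<open>a\<close>\<close>

lemma quot_residue_one_empty:
  assumes "c \<in> {1..P-1}"
  shows "{u \<in> {1..P-1}. quot_residue P u 1 = c} = {}"
  using assms by (auto simp: quot_residue_def)

text \<open>For \<open>a = -1\<close> numerator and denominator both contain the factor
  \<open>-(u + 1)\<close>. It cancels unless \<open>u = P - 1\<close>, leaving
  \<open>(a - 1) ^ 2 = 4\<close>.\<close>

lemma card_quot_residue_minus_one:
  assumes "P > 3" "c \<in> {1..P-1}"
  shows "card {u \<in> {1..P-1}. quot_residue P u (P - 1) = c} = (if c = 4 then nat (P - 2) else 0)"
proof -
  have P4: "P \<noteq> 4" using prime by auto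
  have "quot_residue P u (P - 1) = c \<longleftrightarrow> u \<noteq> P - 1 \<and> c = 4" if u: "u \<in> {1..P-1}" for u
  proof -
    have "\<not> P dvd P - 1"
      using P_gt_1 by (intro not_dvd_range) auto
    then have "quot_residue P u (P - 1) = c \<longleftrightarrow> \<not> P dvd u * (P - 1) - 1 \<and>
       P dvd (u - (P - 1)) * (P - 1 - 1) ^ 2 - c * (P - 1) * (u * (P - 1) - 1)"
      using quot_residue_eq_iff[OF _ assms(2)] by (simp add: cong_iff_dvd_diff)
    also have "u * (P - 1) - 1 = P * u - (u + 1)"
      by (simp add: algebra_simps power2_eq_square)
    also have "P dvd \<dots> \<longleftrightarrow> P dvd u + 1"
      by (simp add: dvd_diff_right_iff)
    also have "(u - (P - 1)) * (P - 1 - 1) ^ 2 - c * (P - 1) * (P * u - (u + 1)) =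
       P * ((u + 1 - P) * (P - 4) - 4 - c * (P * u - u - 1) + c * u) + (u + 1) * (4 - c)"
      by (simp add: algebra_simps power2_eq_square)
    also have "P dvd \<dots> \<longleftrightarrow> P dvd (u + 1) * (4 - c)"
      by (rule dvd_add_right_iff) simp
    also have "P dvd u + 1 \<longleftrightarrow> u = P - 1"
      using u not_dvd_range[of "u + 1"] by (cases "u = P - 1") auto
    also have "P dvd (u + 1) * (4 - c) \<longleftrightarrow> u = P - 1 \<or> c = 4"
    proof -
      have "P dvd u + 1 \<longleftrightarrow> u = P - 1" by fact
      moreover have "P dvd 4 - c \<longleftrightarrow> c = 4"
        using assms P4 not_dvd_range[of "4 - c"] not_dvd_range[of "c - 4"] dvd_minus_iff[of P "4 - c"]
        by (cases c "4 :: int" rule: linorder_cases) auto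
      ultimately show ?thesis by (simp add: dvd_mult_iff)
    qed
    finally show ?thesis by auto
  qed
  then have "{u \<in> {1..P-1}. quot_residue P u (P - 1) = c} = (if c = 4 then {1..P-2} else {})"
    by auto
  then show ?thesis by simp
qed

text \<open>The cleared equation is linear in \<open>u\<close>, with the two exceptional congruences
  marking a solution at 0 or infinity. That \<open>a\<close> is neither 1 nor -1 makes the Moebius
  map nondegenerate.\<close>

lemma card_quot_residue_generic:
  assumes a: "a \<in> {2..P-2}" and c: "c \<in> {1..P-1}"
  shows "card {u \<in> {1..P-1}. quot_residue P u a = c} =
           (if [(a - 1) ^ 2 = c] (mod P) \<or> [(a - 1) ^ 2 = c * a ^ 2] (mod P) then 0 else 1)"
proof -
  have na: "\<not> P dvd a" "\<not> P dvd a - 1" "\<not> P dvd a + 1"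
    using a not_dvd_range[of a] not_dvd_range[of "a - 1"] not_dvd_range[of "a + 1"] by auto
  have nc: "\<not> P dvd c"
    using c by (intro not_dvd_range) auto
  define D where "D = (a - 1) ^ 2 - c * a ^ 2"
  define R where "R = a * ((a - 1) ^ 2 - c)"
  have "quot_residue P u a = c \<longleftrightarrow> [u * D = R] (mod P)" for u
  proof -
    \<comment> \<open>Clearing denominators adds no pole as a solution: \<open>u * a = 1\<close>
      would force \<open>u = a\<close>, hence \<open>a ^ 2 = 1\<close>.\<close>
    have "\<not> P dvd u * a - 1" if *: "[(u - a) * (a - 1) ^ 2 = c * a * (u * a - 1)] (mod P)"
    proof
      assume ua: "P dvd u * a - 1"
      then have "P dvd (u - a) * (a - 1) ^ 2"
        using cong_dvd_iff[OF *] by simp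
      then have "P dvd u - a"
        using na by (simp add: dvd_mult_iff dvd_power2_iff)
      then have "P dvd (u * a - 1) - (u - a) * a"
        by (intro dvd_diff[OF ua] dvd_mult2)
      also have "(u * a - 1) - (u - a) * a = (a - 1) * (a + 1)"
        by (simp add: algebra_simps power2_eq_square)
      finally show False
        using na by (simp add: dvd_mult_iff)
    qed
    then have "quot_residue P u a = c \<longleftrightarrow> P dvd (u - a) * (a - 1) ^ 2 - c * a * (u * a - 1)"
      unfolding quot_residue_eq_iff[OF na(1) c] by (auto simp: cong_iff_dvd_diff)
    also have "(u - a) * (a - 1) ^ 2 - c * a * (u * a - 1) = u * D - R"
      unfolding D_def R_def by (simp add: algebra_simps power2_eq_square)
    finally show ?thesis
      by (simp add: cong_iff_dvd_diff)
  qed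
  moreover have "\<not> (P dvd D \<and> P dvd R)"
  proof
    assume "P dvd D \<and> P dvd R"
    then have "P dvd D" "P dvd (a - 1) ^ 2 - c"
      using na by (auto simp: R_def dvd_mult_iff)
    \<comment> \<open>Eliminating \<open>(a - 1) ^ 2\<close> from the two conditions leaves a
      product of units.\<close>
    then have "P dvd (a - 1) ^ 2 - c - D"
      by (rule dvd_diff[rotated])
    also have "(a - 1) ^ 2 - c - D = c * ((a - 1) * (a + 1))"
      unfolding D_def by (simp add: algebra_simps power2_eq_square)
    finally show False
      using na nc by (simp add: dvd_mult_iff)
  qed
  moreover have "P dvd D \<longleftrightarrow> [(a - 1) ^ 2 = c * a ^ 2] (mod P)"
    by (simp add: D_def cong_iff_dvd_diff)
  moreover have "P dvd R \<longleftrightarrow> [(a - 1) ^ 2 = c] (mod P)"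
    using na by (simp add: R_def cong_iff_dvd_diff dvd_mult_iff)
  ultimately show ?thesis
    using card_linear_cong[of D R] by auto
qed

section \<open>Fibre sizes in terms of the exceptional \<open>a\<close>\<close>

definition excluded :: "int \<Rightarrow> int set" where
  "excluded c = {a \<in> {2..P-2}. [(a - 1) ^ 2 = c] (mod P) \<or> [(a - 1) ^ 2 = c * a ^ 2] (mod P)}"

lemma finite_excluded: "finite (excluded c)"
  by (rule finite_subset[of _ "{2..P-2}"]) (auto simp: excluded_def)

definition fibre :: "int \<Rightarrow> (int \<times> int) set" where
  "fibre c = {(u, a). u \<in> {1..P-1} \<and> a \<in> {1..P-1} \<and> quot_residue P u a = c}"

lemma card_fibre:
  assumes P: "P > 3" and c: "c \<in> {1..P-1}"
  shows "int (card (fibre c)) = (if c = 4 then P - 2 else 0) + (P - 3) - int (card (excluded c))"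
proof -
  let ?r = "\<lambda>a. {u \<in> {1..P-1}. quot_residue P u a = c}"
  have fin: "finite (?r a)" for a
    by (rule finite_subset[of _ "{1..P-1}"]) auto
  define n where "n a = card (?r a)" for a
  have n1: "n 1 = 0"
    unfolding n_def quot_residue_one_empty[OF c] by simp
  have nm: "n (P - 1) = (if c = 4 then nat (P - 2) else 0)"
    unfolding n_def by (rule card_quot_residue_minus_one[OF P c])
  have "(\<Sum>a\<in>{2..P-2}. n a) = (\<Sum>a\<in>{2..P-2}. if a \<in> excluded c then 0 else 1)"
    unfolding n_def
    by (rule sum.cong[OF refl], subst card_quot_residue_generic[OF _ c]) (auto simp: excluded_def)
  also have "\<dots> = card ({2..P-2} - excluded c)"
    by (simp add: sum.If_cases Diff_eq)
  also have "\<dots> = card {2..P-2} - card (excluded c)"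
  proof (rule card_Diff_subset)
    show "excluded c \<subseteq> {2..P-2}"
      by (auto simp: excluded_def)
  qed (rule finite_excluded)
  finally have generic: "(\<Sum>a\<in>{2..P-2}. n a) = card {2..P-2} - card (excluded c)" .
  \<comment> \<open>Swapping the coordinates makes \<open>a\<close> the outer index, so that the
    counts for fixed \<open>a\<close> can be added.\<close>
  have "fibre c = prod.swap ` (SIGMA a:{1..P-1}. ?r a)"
    by (force simp: fibre_def)
  then have "card (fibre c) = card (SIGMA a:{1..P-1}. ?r a)"
    by (simp only: card_image inj_swap)
  also have "\<dots> = (\<Sum>a\<in>{1..P-1}. n a)"
    unfolding n_def by (rule card_SigmaI) (simp, rule ballI, rule fin)
  also have "\<dots> = (\<Sum>a\<in>insert 1 (insert (P - 1) {2..P-2}). n a)"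
    by (rule sum.cong) (use P in auto)
  also have "\<dots> = n 1 + (n (P - 1) + (\<Sum>a\<in>{2..P-2}. n a))"
    using P by simp
  finally have eq: "card (fibre c) =
      (if c = 4 then nat (P - 2) else 0) + (card {2..P-2} - card (excluded c))"
    by (simp add: n1 nm generic)
  \<comment> \<open>This bound makes the subtraction of natural numbers in \<open>eq\<close> a
    genuine one.\<close>
  have "card (excluded c) \<le> card {2..P-2}"
    by (rule card_mono) (auto simp: excluded_def)
  then show ?thesis
    unfolding eq using P by (simp add: of_nat_diff)
qed

section \<open>Inversion modulo \<open>P\<close> and the exceptional \<open>a\<close>\<close>

lemma modular_inverse_eq_iff:
  assumes "a \<in> {2..P-2}"
  shows "modular_inverse P t = a \<longleftrightarrow> P dvd t * a - 1"
proof
  assume eq: "modular_inverse P t = a"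
  \<comment> \<open>The default inverse 0 of a non-unit lies outside the range of
    \<open>a\<close>.\<close>
  have "\<not> P dvd t"
    using eq assms coprime_iff[of t] mult_modular_inverse_of_not_coprime[of t P] by auto
  then show "P dvd t * a - 1"
    using inverse_cong[of t] eq by (simp add: cong_iff_dvd_diff)
next
  assume "P dvd t * a - 1"
  then show "modular_inverse P t = a"
    using assms by (intro modular_inverse_int_eqI) (auto simp: cong_iff_dvd_diff)
qed

lemma modular_inverse_minus_one: "modular_inverse P (P - 1) = P - 1"
proof (rule modular_inverse_int_eqI)
  have "(P - 1) * (P - 1) - 1 = P * (P - 2)"
    by (simp add: algebra_simps)
  then show "[(P - 1) * (P - 1) = 1] (mod P)"
    by (simp add: cong_iff_dvd_diff)
qed (use P_gt_1 in auto)

text \<open>Only 1 and -1 are their own inverses, so inversion maps the remaining units to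
  themselves without fixed points.\<close>

lemma modular_inverse_range:
  assumes x: "x \<in> {2..P-2}"
  shows "modular_inverse P x \<in> {2..P-2}" and "modular_inverse P x \<noteq> x"
proof -
  define y where "y = modular_inverse P x"
  have nx: "\<not> P dvd x" "\<not> P dvd x - 1" "\<not> P dvd x + 1"
    using x not_dvd_range[of x] not_dvd_range[of "x - 1"] not_dvd_range[of "x + 1"] by auto
  have xy: "P dvd x * y - 1"
    using inverse_cong[OF nx(1)] by (simp add: y_def cong_iff_dvd_diff)
  have "0 \<le> y" "y < P"
    using P_gt_1 by (simp_all add: y_def modular_inverse_int_nonneg modular_inverse_int_less)
  moreover have "y \<noteq> 0"
    using xy P_gt_1 by auto
  moreover have "y \<noteq> 1"
    using xy nx by auto
  moreover have "y \<noteq> P - 1"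
  proof
    assume "y = P - 1"
    then have "x * y - 1 = P * x - (x + 1)"
      by (simp only:) (simp add: algebra_simps)
    then have "P dvd P * x - (x + 1)"
      using xy by metis
    then show False
      using nx(3) by (simp add: dvd_diff_right_iff)
  qed
  ultimately show "modular_inverse P x \<in> {2..P-2}"
    by (auto simp: y_def)
  have "x * x - 1 = (x - 1) * (x + 1)"
    by (simp add: algebra_simps)
  then show "modular_inverse P x \<noteq> x"
    using xy nx by (auto simp: y_def dvd_mult_iff)
qed

lemma modular_inverse_inj:
  assumes "x \<in> {2..P-2}" "y \<in> {2..P-2}" "modular_inverse P x = modular_inverse P y"
  shows "x = y"
proof -
  have "P dvd x * modular_inverse P x - 1" "P dvd y * modular_inverse P x - 1"
    using assms modular_inverse_range(1) modular_inverse_eq_iff by metis+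
  then have "modular_inverse P (modular_inverse P x) = x"
    "modular_inverse P (modular_inverse P x) = y"
    using modular_inverse_eq_iff assms(1,2) by (metis mult.commute)+
  then show ?thesis by simp
qed

text \<open>For \<open>c = s ^ 2\<close> both exceptional congruences are differences of squares and
  split into linear factors. Their roots are the residues \<open>1 + s\<close> and
  \<open>1 - s\<close> and the inverses of these; the intersection discards 0 (also as a default
  inverse), 1 and -1.\<close>

lemma excluded_square:
  assumes c: "[c = s ^ 2] (mod P)"
    and t: "t \<in> {0..<P}" "[t = 1 + s] (mod P)"
    and t': "t' \<in> {0..<P}" "[t' = 1 - s] (mod P)"
  shows "excluded c = {t, t', modular_inverse P t, modular_inverse P t'} \<inter> {2..P-2}"
proof -
  have "[(a - 1) ^ 2 = c] (mod P) \<longleftrightarrow> a = t \<or> a = t'" if a: "a \<in> {2..P-2}" for a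
  proof -
    have "[(a - 1) ^ 2 = c] (mod P) \<longleftrightarrow> P dvd (a - 1) ^ 2 - s ^ 2"
      using c by (simp add: cong_def flip: cong_iff_dvd_diff)
    also have "(a - 1) ^ 2 - s ^ 2 = (a - (1 + s)) * (a - (1 - s))"
      by (simp add: algebra_simps power2_eq_square)
    also have "P dvd \<dots> \<longleftrightarrow> [a = t] (mod P) \<or> [a = t'] (mod P)"
      using t t' by (simp add: dvd_mult_iff cong_def flip: cong_iff_dvd_diff)
    also have "\<dots> \<longleftrightarrow> a = t \<or> a = t'"
      using a t t' by (simp add: cong_def)
    finally show ?thesis .
  qed
  moreover have "[(a - 1) ^ 2 = c * a ^ 2] (mod P) \<longleftrightarrow>
      a = modular_inverse P t \<or> a = modular_inverse P t'" if a: "a \<in> {2..P-2}" for a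
  proof -
    have "[c * a ^ 2 = s ^ 2 * a ^ 2] (mod P)"
      by (intro cong_mult c cong_refl)
    then have "[(a - 1) ^ 2 = c * a ^ 2] (mod P) \<longleftrightarrow> P dvd (a - 1) ^ 2 - s ^ 2 * a ^ 2"
      by (simp add: cong_def flip: cong_iff_dvd_diff)
    also have "(a - 1) ^ 2 - s ^ 2 * a ^ 2 = ((1 + s) * a - 1) * ((1 - s) * a - 1)"
      by (simp add: algebra_simps power2_eq_square)
    also have "P dvd \<dots> \<longleftrightarrow> [(1 + s) * a = 1] (mod P) \<or> [(1 - s) * a = 1] (mod P)"
      by (simp add: dvd_mult_iff cong_iff_dvd_diff)
    also have "\<dots> \<longleftrightarrow> [t * a = 1] (mod P) \<or> [t' * a = 1] (mod P)"
      using cong_mult[OF t(2) cong_refl[of a]] cong_mult[OF t'(2) cong_refl[of a]]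
      by (simp add: cong_def)
    also have "\<dots> \<longleftrightarrow> a = modular_inverse P t \<or> a = modular_inverse P t'"
      using modular_inverse_eq_iff[OF a, of t] modular_inverse_eq_iff[OF a, of t']
      unfolding cong_iff_dvd_diff by metis
    finally show ?thesis .
  qed
  ultimately show ?thesis
    by (auto simp: excluded_def)
qed

text \<open>An exceptional \<open>a\<close> would exhibit \<open>c\<close> as the square of the unit
  \<open>a - 1\<close> or of \<open>(a - 1) / a\<close>.\<close>

lemma excluded_nonsquare:
  assumes "\<And>s. \<not> P dvd s \<Longrightarrow> \<not> [s ^ 2 = c] (mod P)"
  shows "excluded c = {}"
proof -
  have False if "a \<in> excluded c" for a
  proof -
    have a: "\<not> P dvd a" "\<not> P dvd a - 1"
      using that not_dvd_range[of a] not_dvd_range[of "a - 1"] by (auto simp: excluded_def)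
    then have *: "[(a - 1) ^ 2 = c * a ^ 2] (mod P)"
      using that assms by (auto simp: excluded_def)
    define b where "b = modular_inverse P a"
    have ab: "[a * b = 1] (mod P)"
      unfolding b_def by (rule inverse_cong[OF a(1)])
    have "[((a - 1) * b) ^ 2 = c * (a * b) ^ 2] (mod P)"
      using cong_mult[OF * cong_refl[of "b ^ 2"]] by (simp add: power_mult_distrib mult_ac)
    also have "[c * (a * b) ^ 2 = c * 1 ^ 2] (mod P)"
      by (intro cong_mult cong_pow ab cong_refl)
    finally have "[((a - 1) * b) ^ 2 = c] (mod P)"
      by simp
    moreover have "\<not> P dvd (a - 1) * b"
      using a by (simp add: dvd_mult_iff b_def dvd_modular_inverse_iff)
    ultimately show False
      using assms by blast
  qed
  then show ?thesis by blast
qed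

text \<open>Here \<open>s = 1\<close>: the root \<open>1 - s = 0\<close> drops out together with its
  default inverse 0.\<close>

lemma card_excluded_one:
  assumes P: "P \<ge> 5"
  shows "card (excluded 1) = 2"
proof -
  have "excluded 1 = {2, 0, modular_inverse P 2, modular_inverse P 0} \<inter> {2..P-2}"
    by (rule excluded_square[where s = 1]) (use P in auto)
  also have "\<dots> = {2, modular_inverse P 2}"
    using P modular_inverse_range[of 2] coprime_iff[of 0] by auto
  finally show ?thesis
    using P modular_inverse_range[of 2] by simp
qed

text \<open>Here \<open>s = 2\<close>: the root \<open>1 - s = -1\<close> is its own inverse and
  lies outside the generic range.\<close>

lemma card_excluded_four:
  assumes P: "P \<ge> 5"
  shows "card (excluded 4) = 2"
proof -
  have "excluded 4 = {3, P - 1, modular_inverse P 3, modular_inverse P (P - 1)} \<inter> {2..P-2}"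
    by (rule excluded_square[where s = 2]) (use P in \<open>auto simp: cong_iff_dvd_diff\<close>)
  also have "\<dots> = {3, modular_inverse P 3}"
    using P modular_inverse_range[of 3] by (auto simp: modular_inverse_minus_one)
  finally show ?thesis
    using P modular_inverse_range[of 3] by simp
qed

text \<open>The four candidates are distinct: inversion is injective without fixed points on the
  generic range, and \<open>t * t'\<close> is \<open>1 - s ^ 2\<close>, not 1, modulo
  \<open>P\<close>.\<close>

lemma card_excluded_square:
  assumes s: "3 \<le> s" "2 * s < P" and c: "[c = s ^ 2] (mod P)"
  shows "card (excluded c) = 4"
proof -
  define t where "t = 1 + s"
  \<comment> \<open>This represents \<open>1 - s\<close>; it is at most \<open>P - 2\<close> because
    \<open>s\<close> is at least 3.\<close>
  define t' where "t' = P + 1 - s"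
  define i where "i = modular_inverse P t"
  define i' where "i' = modular_inverse P t'"
  have t: "t \<in> {2..P-2}" "t' \<in> {2..P-2}"
    using s by (auto simp: t_def t'_def)
  have eq: "excluded c = {t, t', i, i'} \<inter> {2..P-2}"
    unfolding i_def i'_def
    by (rule excluded_square[OF c]) (use t in \<open>auto simp: t_def t'_def cong_iff_dvd_diff\<close>)
  have i: "i \<in> {2..P-2}" "i' \<in> {2..P-2}" "i \<noteq> t" "i' \<noteq> t'"
    unfolding i_def i'_def by (intro modular_inverse_range t)+
  have tt: "t \<noteq> t'"
    using s by (simp add: t_def t'_def)
  have ii: "i \<noteq> i'"
    using modular_inverse_inj[OF t] tt by (auto simp: i_def i'_def)
  have nt: "\<not> P dvd t * t' - 1"
  proof
    assume "P dvd t * t' - 1"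
    also have "t * t' - 1 = P * t - s ^ 2"
      by (simp add: t_def t'_def algebra_simps power2_eq_square)
    finally have "P dvd s"
      by (simp add: dvd_diff_right_iff dvd_power2_iff)
    with s not_dvd_range[of s] show False by simp
  qed
  have "i \<noteq> t'"
    unfolding i_def using modular_inverse_eq_iff[OF t(2)] nt by blast
  moreover have "i' \<noteq> t"
    unfolding i'_def using modular_inverse_eq_iff[OF t(1), of t'] nt by (simp add: mult.commute)
  moreover have "excluded c = {t, t', i, i'}"
    using eq t i by blast
  ultimately show ?thesis
    using tt ii i by auto
qed

section \<open>Squares and the second moment of the fibre sizes\<close>

lemma inj_on_squares: "inj_on (\<lambda>s. s ^ 2 mod P) {s. 1 \<le> s \<and> 2 * s < P}"
proof (rule inj_onI)
  fix r s assume r: "r \<in> {s. 1 \<le> s \<and> 2 * s < P}" and s: "s \<in> {s. 1 \<le> s \<and> 2 * s < P}"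
    and "r ^ 2 mod P = s ^ 2 mod P"
  then have "P dvd r ^ 2 - s ^ 2"
    by (simp add: mod_eq_dvd_iff)
  also have "r ^ 2 - s ^ 2 = (r - s) * (r + s)"
    by (simp add: algebra_simps power2_eq_square)
  \<comment> \<open>Restricting to the lower half gives \<open>0 < r + s < P\<close>, which rules
    out \<open>r = -s\<close>.\<close>
  finally have "P dvd r - s"
    using r s not_dvd_range[of "r + s"] by (simp add: dvd_mult_iff)
  then show "r = s"
    using r s not_dvd_range[of "r - s"] not_dvd_range[of "s - r"] dvd_minus_iff[of P "r - s"]
    by (cases r s rule: linorder_cases) auto
qed

lemma sum_card_fibre_squared:
  assumes P: "P > 3"
  shows "(\<Sum>c\<in>{1..P-1}. int (card (fibre c)) ^ 2) = P ^ 3 - 8 * P ^ 2 + 29 * P - 53"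
proof -
  have "odd P"
    using prime P prime_odd_int by simp
  then obtain h where h: "P = 2 * h + 1"
    by (elim oddE)
  have P5: "P \<ge> 5" and h2: "h \<ge> 2"
    using P h by auto
  \<comment> \<open>With \<open>P = 2 * h + 1\<close>, each nonzero square is \<open>q s\<close> for
    exactly one \<open>s\<close> in \<open>{1..h}\<close>, which leaves \<open>h\<close>
    non-squares.\<close>
  define q where "q s = s ^ 2 mod P" for s
  define F where "F c = int (card (fibre c)) ^ 2" for c
  have half: "{s. 1 \<le> s \<and> 2 * s < P} = {1..h}"
    using h by auto
  have inj: "inj_on q {1..h}"
    using inj_on_squares unfolding half q_def .
  have q_range: "q s \<in> {1..P-1}" if "s \<in> {1..h}" for s
  proof -
    have "\<not> P dvd s"
      using that h by (intro not_dvd_range) auto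
    then have "q s \<noteq> 0"
      by (simp add: q_def dvd_power2_iff flip: dvd_eq_mod_eq_0)
    moreover have "0 \<le> q s" "q s < P"
      using P by (simp_all add: q_def)
    ultimately show ?thesis by auto
  qed
  have q12: "q 1 = 1" "q 2 = 4"
    using P5 by (simp_all add: q_def)
  have F1: "F (q 1) = (P - 5) ^ 2"
    using card_fibre[of 1] card_excluded_one P5 by (simp add: F_def q12)
  have F2: "F (q 2) = (2 * P - 7) ^ 2"
    using card_fibre[of 4] card_excluded_four P5 by (simp add: F_def q12)
  have F3: "F (q s) = (P - 7) ^ 2" if s: "s \<in> {3..h}" for s
  proof -
    \<comment> \<open>Since \<open>q 2 = 4\<close> and \<open>q\<close> is injective, the extra
      solutions from \<open>a = -1\<close> do not occur here.\<close>
    have "q s \<noteq> 4"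
      using inj_onD[OF inj, of s 2] s h2 q12 by auto
    moreover have "card (excluded (q s)) = 4"
      by (rule card_excluded_square[of s]) (use s h in \<open>auto simp: q_def\<close>)
    ultimately show ?thesis
      using card_fibre[OF P q_range[of s]] s by (simp add: F_def)
  qed
  have F4: "F c = (P - 3) ^ 2" if c: "c \<in> {1..P-1} - q ` {1..h}" for c
  proof -
    have "\<not> [x ^ 2 = c] (mod P)" if x: "\<not> P dvd x" for x
    proof
      assume xc: "[x ^ 2 = c] (mod P)"
      define y where "y = x mod P"
      \<comment> \<open>A root in the upper half is replaced by its negative, which has the same
        square.\<close>
      define s where "s = (if y \<le> h then y else P - y)"
      have "y \<noteq> 0"
        using x by (auto simp: y_def)
      moreover have "0 \<le> y" "y < P"
        using P by (simp_all add: y_def)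
      ultimately have s: "s \<in> {1..h}"
        using h by (auto simp: s_def)
      have "[s ^ 2 = y ^ 2] (mod P)"
      proof (cases "y \<le> h")
        case False
        have "(P - y) ^ 2 - y ^ 2 = P * (P - 2 * y)"
          by (simp add: algebra_simps power2_eq_square)
        then show ?thesis
          using False by (simp add: s_def cong_iff_dvd_diff)
      qed (simp add: s_def)
      also have "[y ^ 2 = x ^ 2] (mod P)"
        unfolding y_def by (intro cong_pow) simp
      also note xc
      finally have "q s = c"
        using c by (simp add: q_def cong_def)
      with s c show False by blast
    qed
    then have "excluded c = {}"
      by (rule excluded_nonsquare)
    moreover have "2 \<in> {1..h}"
      using h2 by simp
    then have "c \<noteq> 4"
      using c q12(2) by (metis DiffD2 imageI)
    ultimately show ?thesis
      using card_fibre[OF P, of c] c by (simp add: F_def)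
  qed
  have sub: "q ` {1..h} \<subseteq> {1..P-1}"
    using q_range by blast
  have "card ({1..P-1} - q ` {1..h}) = card {1..P-1} - card (q ` {1..h})"
    by (rule card_Diff_subset[OF _ sub]) simp
  then have card: "int (card ({1..P-1} - q ` {1..h})) = h"
    using h h2 by (simp add: card_image[OF inj])
  have "(\<Sum>c\<in>{1..P-1}. F c) = (\<Sum>c\<in>{1..P-1} - q ` {1..h}. F c) + (\<Sum>c\<in>q ` {1..h}. F c)"
    by (rule sum.subset_diff[OF sub]) simp
  also have "(\<Sum>c\<in>{1..P-1} - q ` {1..h}. F c) = h * (P - 3) ^ 2"
    using card by (simp add: F4 del: Diff_iff)
  also have "(\<Sum>c\<in>q ` {1..h}. F c) = (\<Sum>s\<in>{1..h}. F (q s))"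
    by (simp add: sum.reindex[OF inj])
  also have "{1..h} = insert 1 (insert 2 {3..h})"
    using h2 by auto
  also have "(\<Sum>s\<in>insert 1 (insert 2 {3..h}). F (q s)) = F (q 1) + (F (q 2) + (\<Sum>s\<in>{3..h}. F (q s)))"
    by simp
  also have "(\<Sum>s\<in>{3..h}. F (q s)) = (h - 2) * (P - 7) ^ 2"
    using h2 by (simp add: F3 del: atLeastAtMost_iff)
  \<comment> \<open>After substituting \<open>P = 2 * h + 1\<close> this is a polynomial identity in
    \<open>h\<close>.\<close>
  also have "h * (P - 3) ^ 2 + (F (q 1) + (F (q 2) + (h - 2) * (P - 7) ^ 2)) =
      P ^ 3 - 8 * P ^ 2 + 29 * P - 53"
    unfolding F1 F2 unfolding h by (simp add: algebra_simps power2_eq_square power3_eq_cube)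
  finally show ?thesis
    by (simp add: F_def)
qed

end

section \<open>From the character sum to the fibre sizes\<close>

theorem theorem1p4:
  fixes p :: nat
  assumes "prime p" and "p > 3"
  shows "(\<Sum>\<psi>\<in>dirichlet_chars p.
            (cmod (\<Sum>u = 1..int p - 1. \<Sum>a = 1..int p - 1.
               cnj (\<psi> (u * a - 1)) * \<psi> (u * modular_inverse (int p) a - 1) * \<psi> (a - 1) ^ 2)) ^ 2)
         = (real p - 1) * (real p ^ 3 - 8 * real p ^ 2 + 29 * real p - 53)"
proof -
  define P where "P = int p"
  interpret int_prime P
    by standard (use assms in \<open>simp add: P_def\<close>)
  have p1: "p > 1" using assms by simp
  obtain g where g: "residue_primroot p g"
    using prime_primitive_root_exists[of p] assms by auto
  define I where "I = {1..P-1} \<times> {1..P-1}"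
  define w where "w c = complex_of_nat (card (fibre c))" for c
  have inner: "(\<Sum>u = 1..P-1. \<Sum>a = 1..P-1.
      cnj (\<psi> (u * a - 1)) * \<psi> (u * modular_inverse P a - 1) * \<psi> (a - 1) ^ 2) =
      (\<Sum>c\<in>{1..P-1}. w c * \<psi> c)" if "\<psi> \<in> dirichlet_chars p" for \<psi>
  proof -
    have \<psi>: "dirichlet_char p \<psi>"
      using that by (simp add: dirichlet_chars_def)
    have \<psi>0: "\<psi> 0 = 0"
      using \<psi> p1 by (simp add: dirichlet_char_def)
    \<comment> \<open>Conjugation becomes an inverse in the argument and the square a power, so
      multiplicativity merges the three factors.\<close>
    have "cnj (\<psi> (u * a - 1)) * \<psi> (u * modular_inverse P a - 1) * \<psi> (a - 1) ^ 2 =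
            \<psi> (quot_residue P u a)" for u a
    proof -
      have "\<psi> (x * y) = \<psi> x * \<psi> y" for x y
        using \<psi> by (simp add: dirichlet_char_def)
      then show ?thesis
        using \<psi> by (simp add: quot_residue_def P_def dirichlet_char_mod cnj_dirichlet_char[OF g p1]
            dirichlet_char_power)
    qed
    then have "(\<Sum>u = 1..P-1. \<Sum>a = 1..P-1.
      cnj (\<psi> (u * a - 1)) * \<psi> (u * modular_inverse P a - 1) * \<psi> (a - 1) ^ 2) =
      (\<Sum>x\<in>I. \<psi> (case x of (u, a) \<Rightarrow> quot_residue P u a))"
      by (simp add: I_def sum.cartesian_product split_def)
    also have "\<dots> = (\<Sum>c\<in>{0..<P}. \<Sum>x\<in>{x \<in> I. (case x of (u, a) \<Rightarrow> quot_residue P u a) = c}.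
                       \<psi> (case x of (u, a) \<Rightarrow> quot_residue P u a))"
      by (rule sum.group[symmetric]) (use P_gt_1 in \<open>auto simp: I_def quot_residue_def\<close>)
    also have "\<dots> = (\<Sum>c\<in>{0..<P}. w c * \<psi> c)"
    proof (rule sum.cong[OF refl])
      fix c
      have "{x \<in> I. (case x of (u, a) \<Rightarrow> quot_residue P u a) = c} = fibre c"
        by (auto simp: I_def fibre_def)
      moreover have "(\<Sum>x\<in>fibre c. \<psi> (case x of (u, a) \<Rightarrow> quot_residue P u a)) = (\<Sum>x\<in>fibre c. \<psi> c)"
        by (rule sum.cong) (auto simp: fibre_def)
      ultimately show "(\<Sum>x\<in>{x \<in> I. (case x of (u, a) \<Rightarrow> quot_residue P u a) = c}.
                         \<psi> (case x of (u, a) \<Rightarrow> quot_residue P u a)) = w c * \<psi> c"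
        by (simp add: w_def)
    qed
    \<comment> \<open>Pairs with residue 0 contribute nothing because \<open>\<psi> 0 = 0\<close>;
      only units remain, as Parseval requires.\<close>
    also have "{0..<P} = insert 0 {1..P-1}"
      using P_gt_1 by auto
    also have "(\<Sum>c\<in>insert 0 {1..P-1}. w c * \<psi> c) = (\<Sum>c\<in>{1..P-1}. w c * \<psi> c)"
      by (simp add: \<psi>0)
    finally show ?thesis .
  qed
  have "(\<Sum>\<psi>\<in>dirichlet_chars p.
            (cmod (\<Sum>u = 1..P - 1. \<Sum>a = 1..P - 1.
               cnj (\<psi> (u * a - 1)) * \<psi> (u * modular_inverse P a - 1) * \<psi> (a - 1) ^ 2)) ^ 2) =
        (\<Sum>\<psi>\<in>dirichlet_chars p. cmod (\<Sum>c\<in>{1..P-1}. w c * \<psi> c) ^ 2)"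
    by (simp add: inner)
  also have "\<dots> = real (totient p) * (\<Sum>c\<in>{1..P-1}. cmod (w c) ^ 2)"
  proof (rule dirichlet_chars_parseval[OF g p1])
    show "coprime c (int p)" if "c \<in> {1..P-1}" for c
      using that not_dvd_range[of c] coprime_iff[of c] by (simp add: P_def)
  qed (auto simp: P_def)
  also have "(\<Sum>c\<in>{1..P-1}. cmod (w c) ^ 2) = real_of_int (\<Sum>c\<in>{1..P-1}. int (card (fibre c)) ^ 2)"
    by (simp add: w_def)
  also have "(\<Sum>c\<in>{1..P-1}. int (card (fibre c)) ^ 2) = P ^ 3 - 8 * P ^ 2 + 29 * P - 53"
    by (rule sum_card_fibre_squared) (use assms in \<open>simp add: P_def\<close>)
  also have "real (totient p) = real p - 1"
    using assms by (simp add: totient_prime of_nat_diff)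
  finally show ?thesis
    by (simp add: P_def)
qed

end
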